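(* Let $\Omega=\{h\in\mathbb{R}^I : A_\Omega^\top h+B_\Omega^\top\eta=b_\Omega \text{ for some } \eta\ge 0\}$ with $b_\Omega\in\mathbb{R}^k$ be a polytope (in particular compact), where $\eta\ge 0$ denotes potential nonnegative slack variables in the rows. Let $\beta^-,\beta^+\in\mathbb{R}^J$ be a lower and an upper bound for $\beta$, and $h^-,h^+\in\mathbb{R}^I$ a lower and an upper bound for $h$, in the sense of the Boundedness Assumption of the context. Let $y'\in\{0,1\}^l$ be the fixed integer assignment, and let $Ay\ge b$ be the system consisting of $A'y\ge b'$ and $A_fy\ge b_f$. Then the optimal value of the following program (linear apart from the term $G(x)$), in the variables $x$, $y\in\mathbb{R}^{n+l}$, $u_\beta^+,u_\beta^-\in\mathbb{R}^J$, $u_\Omega\in\mathbb{R}^k$, $u^{1},u^{2},u^{3},u^{4}\in\mathbb{R}^{I\times J}$, is an upper bound on the optimal value of $$\min_{x\in\mathcal{X}} G(x)+\max_{h\in\Omega}\ \min_{y\in\mathcal{Y}(x,h)}c^\top y:$$ $$\begin{aligned} \min\ & G(x)+(\beta^+)^\top u_\beta^+ +(\beta^-)^\top u_\beta^- + b_\Omega^\top u_\Omega + c^\top y\\ &-\sum_{i\in I,j\in J}\left(h_i^-\beta_j^-u^1_{ij}+h_i^+\beta_j^+u^2_{ij}+h_i^+\beta_j^-u^3_{ij}+h_i^-\beta_j^+u^4_{ij}\right)\\ \text{s.t. } & Ay\ge b,\\ & (By)_j+(u_\beta^+)_j+(u_\beta^-)_j-\sum_{i\in I}\left(h_i^-u^1_{ij}+h_i^+u^2_{ij}+h_i^+u^3_{ij}+h_i^-u^4_{ij}\right)\ge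 (B_xx+b_0)_j && \forall j\in J,\\ & u_\beta^+\ge 0,\quad -u_\beta^-\ge 0,\\ & (A_\Omega u_\Omega)_i-\sum_{j\in J}\left(\beta_j^-u^1_{ij}+\beta_j^+u^2_{ij}+\beta_j^-u^3_{ij}+\beta_j^+u^4_{ij}\right)\ge 0 && \forall i\in I,\\ & B_\Omega u_\Omega\ge 0,\\ & u^1_{ij}+u^2_{ij}+u^3_{ij}+u^4_{ij}\ge (B_h)_{ij} && \forall i\in I,\ j\in J,\\ & -u^1_{ij}\ge 0,\quad -u^2_{ij}\ge 0,\quad u^3_{ij}\ge 0,\quad u^4_{ij}\ge 0 && \forall i\in I,\ j\in J,\\ & x\in\mathcal{X}. \end{aligned}$$
   Context: Setting (weakly connected adjustable robust problem). $\mathcal{X}$ is a polytope of first-level decisions, $G$ is a real-valued first-level cost function on $\mathcal{X}$, $\Omega\subseteq\mathbb{R}^I$ is the polytope of uncertainties $h$ ($I$ a finite index set), and $c\in\mathbb{R}^{n+l}$. The third-level feasible set is $$\mathcal{Y}(x,h)=\{y\in\mathbb{R}^n\times\{0,1\}^l:\ A'y\ge b',\ By\ge B_xx+B_hh+b_0\},$$ i.e. $x$ and $h$ affect only the right-hand side of the constraints. $J$ is the finite index set of the rows of $By\ge B_xx+B_hh+b_0$. The symbol $(B_h)_{ij}$, $i\in I$, $j\in J$, denotes the coefficient of $h_i$ in the $j$-th component of $B_hh$, so that $(B_hh)^\top\beta=\sum_{i\in I,j\in J}(B_h)_{ij}h_i\beta_j$. Fixing of integers. The integer variables are fixed to a vector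 $y'\in\{0,1\}^l$, i.e. $(y_{n+1},\dots,y_{n+l})^\top=y'$, by a system of linear inequalities $A_fy\ge b_f$. Put $A^\top=((A')^\top,A_f^\top)$ and $b^\top=((b')^\top,b_f^\top)$. The third-level LP for this fixing is $\min\{c^\top y: Ay\ge b,\ By\ge B_xx+B_hh+b_0\}$ and its dual is $$\max\{b^\top\alpha+(B_xx+B_hh+b_0)^\top\beta:\ A^\top\alpha+B^\top\beta=c,\ \alpha,\beta\ge 0\},$$ with $\beta\in\mathbb{R}^J$ the dual variables of $By\ge B_xx+B_hh+b_0$. Boundedness Assumption. There are $\beta^-\le\beta^+$ in $\mathbb{R}^J$ and $h^-\le h^+$ in $\mathbb{R}^I$ such that adding $h^-\le h\le h^+$ to $\Omega$ and $\beta^-\le\beta\le\beta^+$ to the dual program does not affect the outcome of the trilevel problem; that is, $\min_{x\in\mathcal{X}}G(x)+\max_{h\in\Omega}\min\{c^\top y: Ay\ge b, By\ge B_xx+B_hh+b_0\}$ has the same optimal value as the problem obtained by replacing $\Omega$ by $\{h\in\Omega:h^-\le h\le h^+\}$ and the inner minimum by the dual program above with the additional constraint $\beta^-\le\beta\le\beta^+$. (Compactness of $\Omega$ already yields such $h^-,h^+$.)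
   Formalization: The formal theorem additionally assumes that every h in Ω with h⁻ ≤ h ≤ h⁺ is componentwise nonnegative; without this sign condition the claim fails (for example for Ω = {-1}), because the program's rows for u_Ω and for (B_h)_ij are inequalities. *)

theory Defs
  imports "HOL-Analysis.Analysis"
begin

text \<open>
  Vectors are ordered componentwise, and all optimal values are infima and suprema in
  \<^typ>\<open>ereal\<close>: an infeasible minimisation has value \<open>\<infinity>\<close>, an infeasible maximisation
  \<open>-\<infinity>\<close>, and no optimum is required to be attained.
\<close>

definition vstack :: "'a ^ 'p \<Rightarrow> 'a ^ 'q \<Rightarrow> 'a ^ ('p::finite + 'q::finite)" where
  "vstack u v = (\<chi> r. case r of Inl i \<Rightarrow> u $ i | Inr i \<Rightarrow> v $ i)"

definition coupling_rhs ::
  "real ^ 'm ^ 'j \<Rightarrow> real ^ 'i ^ 'j \<Rightarrow> real ^ 'j \<Rightarrow> real ^ 'm \<Rightarrow> real ^ 'i \<Rightarrow> real ^ 'j" where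
  "coupling_rhs Bx Bh b0 x h = Bx *v x + Bh *v h + b0"

text \<open>
  The variables are indexed by a sum type: \<^const>\<open>Inl\<close> indexes the continuous and
  \<^const>\<open>Inr\<close> the binary ones.
\<close>

definition third_level_set ::
  "real ^ ('n::finite + 'l::finite) ^ 'p \<Rightarrow> real ^ 'p \<Rightarrow> real ^ ('n::finite + 'l::finite) ^ 'j \<Rightarrow> real ^ 'j
    \<Rightarrow> (real ^ ('n::finite + 'l::finite)) set" where
  "third_level_set A' b' B r =
     {y. (\<forall>i. y $ Inr i \<in> {0, 1}) \<and> A' *v y \<ge> b' \<and> B *v y \<ge> r}"

definition lp_set ::
  "real ^ 'v ^ 'p \<Rightarrow> real ^ 'p \<Rightarrow> real ^ 'v ^ 'j \<Rightarrow> real ^ 'j \<Rightarrow> (real ^ 'v) set" where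
  "lp_set A b B r = {y. A *v y \<ge> b \<and> B *v y \<ge> r}"

definition min_value :: "real ^ 'v \<Rightarrow> (real ^ 'v) set \<Rightarrow> ereal" where
  "min_value c Y = (INF y\<in>Y. ereal (c \<bullet> y))"

definition bounded_dual_value ::
  "real ^ 'v \<Rightarrow> real ^ 'v ^ 'p \<Rightarrow> real ^ 'p \<Rightarrow> real ^ 'v ^ 'j \<Rightarrow> real ^ 'j
    \<Rightarrow> real ^ 'j \<Rightarrow> real ^ 'j \<Rightarrow> ereal" where
  "bounded_dual_value c A b B r \<beta>lo \<beta>up =
     (SUP (\<alpha>, \<beta>) \<in> {(\<alpha>, \<beta>). transpose A *v \<alpha> + transpose B *v \<beta> = c \<and> \<alpha> \<ge> 0 \<and> \<beta> \<ge> 0 \<and>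
                             \<beta>lo \<le> \<beta> \<and> \<beta> \<le> \<beta>up}.
        ereal (b \<bullet> \<alpha> + r \<bullet> \<beta>))"

definition trilevel_value ::
  "(real ^ 'm) set \<Rightarrow> (real ^ 'm \<Rightarrow> real) \<Rightarrow> (real ^ 'i) set
    \<Rightarrow> (real ^ 'm \<Rightarrow> real ^ 'i \<Rightarrow> ereal) \<Rightarrow> ereal" where
  "trilevel_value X G \<Omega> V = (INF x\<in>X. ereal (G x) + (SUP h\<in>\<Omega>. V x h))"

end

theory Submission
  imports Defs
begin

text \<open>
  Everything follows from weak duality, applied twice, and a linear overestimation of the only
  nonlinear term.  Fixing the binary variables shrinks the third-level set, so it cannot lower the
  trilevel value; by the boundedness assumption the new value is that of the problem whose
  inner maximisation runs over the box-constrained uncertainties \<open>h\<close> and dual points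
  \<open>(\<alpha>, \<beta>)\<close>.  It therefore suffices to bound the dual objective at each such point by the
  objective of the compact program at each of its feasible points.

  The dual objective is bilinear in \<open>(h, \<beta>)\<close>.  The variables of the compact program
  are multipliers certifying an upper bound: \<open>y\<close> prices the dual equation
  (lemma \<open>dual_objective_le\<close>), \<open>u\<Omega>\<close> prices the equation that describes \<open>\<Omega>\<close>
  (lemma \<open>inner_le_of_polyhedron_certificate\<close>), \<open>u\<beta>p\<close> and \<open>u\<beta>m\<close> price the bounds
  on \<open>\<beta>\<close>, and \<open>u1, \<dots>, u4\<close> price the four McCormick inequalities for the products
  \<open>h\<^sub>i \<beta>\<^sub>j\<close> (lemma \<open>mccormick_multiplier_bound\<close>).  Adding up the priced
  inequalities gives lemma \<open>dual_objective_le_compact_objective\<close>.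
\<close>

section \<open>Weak duality\<close>

lemma inner_right_mono_vec:
  fixes u v w :: "real ^ 'a"
  assumes "u \<le> v" "0 \<le> w"
  shows "u \<bullet> w \<le> v \<bullet> w"
  using assms by (auto simp: inner_vec_def less_eq_vec_def intro!: sum_mono mult_right_mono)

lemma inner_transpose_mult:
  fixes M :: "real ^ 'a ^ 'b"
  shows "(transpose M *v v) \<bullet> w = v \<bullet> (M *v w)"
  by (simp add: dot_lmul_matrix)

text \<open>
  Weak duality: multiplying \<open>A y \<ge> b\<close> by \<open>\<alpha>\<close> and eliminating \<open>A\<^sup>T \<alpha>\<close> with the
  dual equation.  The rows of \<open>B\<close> are kept as a residual instead of being assumed satisfied,
  because the compact program only satisfies them after relaxation by its multipliers.
\<close>

lemma dual_objective_le:
  fixes A :: "real ^ 'v ^ 'p" and B :: "real ^ 'v ^ 'j"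
  assumes "transpose A *v \<alpha> + transpose B *v \<beta> = c" "0 \<le> \<alpha>" "b \<le> A *v y"
  shows "b \<bullet> \<alpha> + r \<bullet> \<beta> \<le> c \<bullet> y + (r - B *v y) \<bullet> \<beta>"
proof -
  have "b \<bullet> \<alpha> \<le> (A *v y) \<bullet> \<alpha>"
    using assms by (intro inner_right_mono_vec)
  moreover have "c \<bullet> y = \<alpha> \<bullet> (A *v y) + \<beta> \<bullet> (B *v y)"
    unfolding assms(1)[symmetric] inner_add_left inner_transpose_mult ..
  ultimately show ?thesis
    by (simp add: inner_diff_left inner_diff_right inner_commute)
qed

text \<open>
  Weak duality for maximising a linear function over the projection of
  \<open>{(h, \<eta>). C\<^sup>T h + D\<^sup>T \<eta> = d, \<eta> \<ge> 0}\<close>.  Because the sign of \<open>h\<close> is not part of the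
  description, it has to be supplied to relax the dual equation \<open>C u = q\<close> to \<open>q \<le> C u\<close>.
\<close>

lemma inner_le_of_polyhedron_certificate:
  fixes C :: "real ^ 'k ^ 'i" and D :: "real ^ 'k ^ 's"
  assumes "transpose C *v h + transpose D *v \<eta> = d" "0 \<le> \<eta>" "0 \<le> h"
    and "q \<le> C *v u" "0 \<le> D *v u"
  shows "q \<bullet> h \<le> d \<bullet> u"
proof -
  have "q \<bullet> h \<le> (C *v u) \<bullet> h"
    using assms by (intro inner_right_mono_vec)
  moreover have "0 \<le> (D *v u) \<bullet> \<eta>"
    using inner_right_mono_vec[OF assms(5,2)] by simp
  moreover have "d \<bullet> u = h \<bullet> (C *v u) + \<eta> \<bullet> (D *v u)"
    unfolding assms(1)[symmetric] inner_add_left inner_transpose_mult ..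
  ultimately show ?thesis
    by (simp add: inner_commute)
qed

section \<open>McCormick relaxation of the bilinear term\<close>

text \<open>
  On a box, each of the products \<open>(s - l) (t - m)\<close>, \<open>(s - L) (t - M)\<close>, \<open>(s - L) (t - m)\<close> and
  \<open>(s - l) (t - M)\<close> has a fixed sign.  Expanded, these are the McCormick inequalities, which
  bound \<open>s t\<close> by affine functions: from below in the first two cases, hence the nonpositive
  multipliers, and from above in the other two.  Nonnegativity of \<open>s\<close> and \<open>t\<close> allows the
  multipliers to sum to more than the coefficient \<open>a\<close>.
\<close>

lemma mccormick_multiplier_bound:
  fixes s t l L m M a u1 u2 u3 u4 :: real
  assumes "l \<le> s" "s \<le> L" "m \<le> t" "t \<le> M" "0 \<le> s" "0 \<le> t"
    and "a \<le> u1 + u2 + u3 + u4" "u1 \<le> 0" "u2 \<le> 0" "0 \<le> u3" "0 \<le> u4"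
  shows "a * s * t \<le> (l * u1 + L * u2 + L * u3 + l * u4) * t
           + (m * u1 + M * u2 + m * u3 + M * u4) * s
           - (l * m * u1 + L * M * u2 + L * m * u3 + l * M * u4)"
proof -
  have "a * (s * t) \<le> (u1 + u2 + u3 + u4) * (s * t)"
    using assms by (intro mult_right_mono) auto
  moreover have "u1 * ((s - l) * (t - m)) \<le> 0"
    using assms by (intro mult_nonpos_nonneg mult_nonneg_nonneg) auto
  moreover have "u2 * ((s - L) * (t - M)) \<le> 0"
    using assms by (intro mult_nonpos_nonneg mult_nonpos_nonpos) auto
  moreover have "u3 * ((s - L) * (t - m)) \<le> 0"
    using assms by (intro mult_nonneg_nonpos mult_nonpos_nonneg) auto
  moreover have "u4 * ((s - l) * (t - M)) \<le> 0"
    using assms by (intro mult_nonneg_nonpos mult_nonneg_nonpos) auto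
  ultimately show ?thesis
    by (simp add: algebra_simps)
qed

text \<open>
  Summing the scalar bound over all index pairs regroups the affine terms into a linear
  function of \<open>\<beta>\<close> and a linear function of \<open>h\<close>; these are the quantities that enter the
  rows of \<open>B\<close> and of \<open>A\<^sub>\<Omega>\<close> in the compact program.
\<close>

lemma mccormick_bilinear_bound:
  fixes Bh :: "real ^ 'i ^ 'j" and h hlo hup :: "real ^ 'i" and \<beta> \<beta>lo \<beta>up :: "real ^ 'j"
    and u1 u2 u3 u4 :: "real ^ 'j ^ 'i"
  assumes h: "hlo \<le> h" "h \<le> hup" "0 \<le> h"
    and \<beta>: "\<beta>lo \<le> \<beta>" "\<beta> \<le> \<beta>up" "0 \<le> \<beta>"
    and cover: "\<And>i j. Bh $ j $ i \<le> u1 $ i $ j + u2 $ i $ j + u3 $ i $ j + u4 $ i $ j"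
    and sign: "\<And>i j. u1 $ i $ j \<le> 0" "\<And>i j. u2 $ i $ j \<le> 0"
      "\<And>i j. 0 \<le> u3 $ i $ j" "\<And>i j. 0 \<le> u4 $ i $ j"
  shows "(Bh *v h) \<bullet> \<beta>
    \<le> (\<chi> j. \<Sum>i\<in>UNIV. hlo $ i * u1 $ i $ j + hup $ i * u2 $ i $ j
                       + hup $ i * u3 $ i $ j + hlo $ i * u4 $ i $ j) \<bullet> \<beta>
     + (\<chi> i. \<Sum>j\<in>UNIV. \<beta>lo $ j * u1 $ i $ j + \<beta>up $ j * u2 $ i $ j
                       + \<beta>lo $ j * u3 $ i $ j + \<beta>up $ j * u4 $ i $ j) \<bullet> h
     - (\<Sum>i\<in>UNIV. \<Sum>j\<in>UNIV.
           hlo $ i * \<beta>lo $ j * u1 $ i $ j + hup $ i * \<beta>up $ j * u2 $ i $ j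
         + hup $ i * \<beta>lo $ j * u3 $ i $ j + hlo $ i * \<beta>up $ j * u4 $ i $ j)"
    (is "_ \<le> (\<chi> j. \<Sum>i\<in>UNIV. ?p i j) \<bullet> \<beta> + (\<chi> i. \<Sum>j\<in>UNIV. ?q i j) \<bullet> h
           - (\<Sum>i\<in>UNIV. \<Sum>j\<in>UNIV. ?s i j)")
proof -
  have "(Bh *v h) \<bullet> \<beta> = (\<Sum>j\<in>UNIV. \<Sum>i\<in>UNIV. Bh $ j $ i * h $ i * \<beta> $ j)"
    by (simp add: inner_vec_def matrix_vector_mult_def sum_distrib_right)
  also have "\<dots> = (\<Sum>i\<in>UNIV. \<Sum>j\<in>UNIV. Bh $ j $ i * h $ i * \<beta> $ j)"
    by (rule sum.swap)
  also have "\<dots> \<le> (\<Sum>i\<in>UNIV. \<Sum>j\<in>UNIV. ?p i j * \<beta> $ j + ?q i j * h $ i - ?s i j)"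
    using assms by (intro sum_mono mccormick_multiplier_bound) (auto simp: less_eq_vec_def)
  also have "\<dots> = (\<Sum>i\<in>UNIV. \<Sum>j\<in>UNIV. ?p i j * \<beta> $ j)
      + (\<Sum>i\<in>UNIV. \<Sum>j\<in>UNIV. ?q i j * h $ i) - (\<Sum>i\<in>UNIV. \<Sum>j\<in>UNIV. ?s i j)"
    by (simp only: sum.distrib sum_subtractf)
  also have "(\<Sum>i\<in>UNIV. \<Sum>j\<in>UNIV. ?p i j * \<beta> $ j) = (\<chi> j. \<Sum>i\<in>UNIV. ?p i j) \<bullet> \<beta>"
    by (subst sum.swap) (simp only: inner_vec_def vec_lambda_beta inner_real_def sum_distrib_right)
  also have "(\<Sum>i\<in>UNIV. \<Sum>j\<in>UNIV. ?q i j * h $ i) = (\<chi> i. \<Sum>j\<in>UNIV. ?q i j) \<bullet> h"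
    by (simp only: inner_vec_def vec_lambda_beta inner_real_def sum_distrib_right)
  finally show ?thesis .
qed

section \<open>The compact program bounds the trilevel value\<close>

text \<open>
  With \<open>P\<close> and \<open>Q\<close> the coefficient vectors of the McCormick bound \<open>P \<bullet> \<beta> + Q \<bullet> h\<close>
  (up to a constant), the rows of \<open>B\<close> in the compact program say that \<open>y\<close>, \<open>up\<close> and
  \<open>um\<close> pay for \<open>r + P\<close>, and the rows of \<open>C\<close> say that \<open>u\<close> pays for \<open>Q\<close>.  Here \<open>r\<close> is
  the part of the right-hand side that is independent of \<open>h\<close>.
\<close>

lemma dual_objective_le_compact_objective:
  fixes A :: "real ^ 'v ^ 'p" and B :: "real ^ 'v ^ 'j" and Bh :: "real ^ 'i ^ 'j"
    and C :: "real ^ 'k ^ 'i" and D :: "real ^ 'k ^ 's"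
    and u1 u2 u3 u4 :: "real ^ 'j ^ 'i"
  assumes dual: "transpose A *v \<alpha> + transpose B *v \<beta> = c" "0 \<le> \<alpha>" "0 \<le> \<beta>"
    and \<beta>: "\<beta>lo \<le> \<beta>" "\<beta> \<le> \<beta>up"
    and scenario: "transpose C *v h + transpose D *v \<eta> = d" "0 \<le> \<eta>"
    and h: "hlo \<le> h" "h \<le> hup" "0 \<le> h"
    and y: "b \<le> A *v y"
    and rows: "\<And>j. r $ j \<le> (B *v y) $ j + up $ j + um $ j
       - (\<Sum>i\<in>UNIV. hlo $ i * u1 $ i $ j + hup $ i * u2 $ i $ j
                    + hup $ i * u3 $ i $ j + hlo $ i * u4 $ i $ j)"
    and bound_mult: "0 \<le> up" "um \<le> 0"
    and u_rows: "\<And>i. 0 \<le> (C *v u) $ i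
       - (\<Sum>j\<in>UNIV. \<beta>lo $ j * u1 $ i $ j + \<beta>up $ j * u2 $ i $ j
                    + \<beta>lo $ j * u3 $ i $ j + \<beta>up $ j * u4 $ i $ j)" "0 \<le> D *v u"
    and cover: "\<And>i j. Bh $ j $ i \<le> u1 $ i $ j + u2 $ i $ j + u3 $ i $ j + u4 $ i $ j"
    and sign: "\<And>i j. u1 $ i $ j \<le> 0" "\<And>i j. u2 $ i $ j \<le> 0"
      "\<And>i j. 0 \<le> u3 $ i $ j" "\<And>i j. 0 \<le> u4 $ i $ j"
  shows "b \<bullet> \<alpha> + (r + Bh *v h) \<bullet> \<beta>
    \<le> \<beta>up \<bullet> up + \<beta>lo \<bullet> um + d \<bullet> u + c \<bullet> y
     - (\<Sum>i\<in>UNIV. \<Sum>j\<in>UNIV.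
           hlo $ i * \<beta>lo $ j * u1 $ i $ j + hup $ i * \<beta>up $ j * u2 $ i $ j
         + hup $ i * \<beta>lo $ j * u3 $ i $ j + hlo $ i * \<beta>up $ j * u4 $ i $ j)"
proof -
  define P where "P = (\<chi> j. \<Sum>i\<in>UNIV. hlo $ i * u1 $ i $ j + hup $ i * u2 $ i $ j
                       + hup $ i * u3 $ i $ j + hlo $ i * u4 $ i $ j)"
  define Q where "Q = (\<chi> i. \<Sum>j\<in>UNIV. \<beta>lo $ j * u1 $ i $ j + \<beta>up $ j * u2 $ i $ j
                       + \<beta>lo $ j * u3 $ i $ j + \<beta>up $ j * u4 $ i $ j)"
  have "b \<bullet> \<alpha> + (r + Bh *v h) \<bullet> \<beta> \<le> c \<bullet> y + (r + Bh *v h - B *v y) \<bullet> \<beta>"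
    using dual(1,2) y by (rule dual_objective_le)
  moreover have "(r - B *v y) \<bullet> \<beta> \<le> (up + um - P) \<bullet> \<beta>"
  proof (rule inner_right_mono_vec[OF _ dual(3)])
    show "r - B *v y \<le> up + um - P"
      unfolding less_eq_vec_def
    proof
      fix j show "(r - B *v y) $ j \<le> (up + um - P) $ j"
        using rows[of j] by (simp add: P_def)
    qed
  qed
  moreover have "\<beta> \<bullet> up \<le> \<beta>up \<bullet> up"
    using \<beta>(2) bound_mult(1) by (rule inner_right_mono_vec)
  moreover have "\<beta>lo \<bullet> (- um) \<le> \<beta> \<bullet> (- um)"
    using \<beta>(1) bound_mult(2) by (intro inner_right_mono_vec) (auto simp: less_eq_vec_def)
  moreover have "Q \<bullet> h \<le> d \<bullet> u"
    using scenario h(3) _ u_rows(2)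
  proof (rule inner_le_of_polyhedron_certificate)
    show "Q \<le> C *v u"
      using u_rows(1) by (simp add: Q_def less_eq_vec_def)
  qed
  moreover note mccormick_bilinear_bound[OF h \<beta> dual(3) cover sign, folded P_def Q_def]
  ultimately show ?thesis
    by (simp add: inner_add_right inner_diff_right inner_commute[of _ \<beta>])
qed

lemma trilevel_value_mono:
  assumes "\<And>x h. x \<in> X \<Longrightarrow> h \<in> \<Omega> \<Longrightarrow> V x h \<le> W x h"
  shows "trilevel_value X G \<Omega> V \<le> trilevel_value X G \<Omega> W"
  unfolding trilevel_value_def using assms
  by (intro INF_superset_mono add_left_mono SUP_subset_mono order_refl)

lemma trilevel_value_le:
  assumes "x \<in> X" "\<And>h. h \<in> \<Omega> \<Longrightarrow> V x h \<le> ereal v"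
  shows "trilevel_value X G \<Omega> V \<le> ereal (G x + v)"
proof -
  have "trilevel_value X G \<Omega> V \<le> ereal (G x) + (SUP h\<in>\<Omega>. V x h)"
    unfolding trilevel_value_def using assms(1) by (rule INF_lower)
  also have "\<dots> \<le> ereal (G x) + ereal v"
    using assms(2) by (intro add_left_mono SUP_least)
  finally show ?thesis by simp
qed

text \<open>
  The appended rows determine the binary part of \<open>y\<close>, so every point of the linear program is
  an admissible third-level decision.  The other integer assignments are lost here; besides the
  McCormick relaxation, this is where the upper bound can fail to be tight.
\<close>

lemma lp_set_fixing_subset_third_level_set:
  assumes "\<forall>i. y' $ i \<in> {0, 1}"
    and "\<forall>y. A\<^sub>f *v y \<ge> b\<^sub>f \<longleftrightarrow> (\<forall>i. y $ Inr i = y' $ i)"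
  shows "lp_set (vstack A' A\<^sub>f) (vstack b' b\<^sub>f) B r \<subseteq> third_level_set A' b' B r"
proof
  fix y assume y: "y \<in> lp_set (vstack A' A\<^sub>f) (vstack b' b\<^sub>f) B r"
  hence rows: "vstack b' b\<^sub>f $ k \<le> (vstack A' A\<^sub>f *v y) $ k" for k
    by (simp add: lp_set_def less_eq_vec_def)
  have "b' \<le> A' *v y"
    unfolding less_eq_vec_def
  proof
    fix i show "b' $ i \<le> (A' *v y) $ i"
      using rows[of "Inl i"] by (simp add: vstack_def matrix_vector_mult_def)
  qed
  moreover have "b\<^sub>f \<le> A\<^sub>f *v y"
    unfolding less_eq_vec_def
  proof
    fix i show "b\<^sub>f $ i \<le> (A\<^sub>f *v y) $ i"
      using rows[of "Inr i"] by (simp add: vstack_def matrix_vector_mult_def)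
  qed
  ultimately show "y \<in> third_level_set A' b' B r"
    using assms y by (simp add: third_level_set_def lp_set_def)
qed

theorem theorem1:
  fixes X :: "(real ^ 'm) set" and G :: "real ^ 'm \<Rightarrow> real"
    and \<Omega> :: "(real ^ 'i) set"
    and A\<^sub>\<Omega> :: "real ^ 'k ^ 'i" and B\<^sub>\<Omega> :: "real ^ 'k ^ 's" and b\<^sub>\<Omega> :: "real ^ 'k"
    and c :: "real ^ ('n::finite + 'l::finite)"
    and A' :: "real ^ ('n::finite + 'l::finite) ^ 'p" and b' :: "real ^ 'p"
    and A\<^sub>f :: "real ^ ('n::finite + 'l::finite) ^ 'q" and b\<^sub>f :: "real ^ 'q"
    and A :: "real ^ ('n::finite + 'l::finite) ^ ('p::finite + 'q::finite)" and b :: "real ^ ('p::finite + 'q::finite)"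
    and y' :: "real ^ 'l"
    and B :: "real ^ ('n::finite + 'l::finite) ^ 'j" and B\<^sub>x :: "real ^ 'm ^ 'j" and B\<^sub>h :: "real ^ 'i ^ 'j"
    and b\<^sub>0 :: "real ^ 'j"
    and \<beta>lo \<beta>up :: "real ^ 'j" and hlo hup :: "real ^ 'i"
  assumes X_polytope: "polytope X"
    and \<Omega>_eq: "\<Omega> = {h. \<exists>\<eta>. \<eta> \<ge> 0 \<and> transpose A\<^sub>\<Omega> *v h + transpose B\<^sub>\<Omega> *v \<eta> = b\<^sub>\<Omega>}"
    and \<Omega>_polytope: "polytope \<Omega>"
    and y'_binary: "\<forall>i. y' $ i \<in> {0, 1}"
    and fixing: "\<forall>y. A\<^sub>f *v y \<ge> b\<^sub>f \<longleftrightarrow> (\<forall>i. y $ Inr i = y' $ i)"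
    and A_eq: "A = vstack A' A\<^sub>f" and b_eq: "b = vstack b' b\<^sub>f"
    and \<beta>_bounds: "\<beta>lo \<le> \<beta>up" and h_bounds: "hlo \<le> hup"
    and bounds_valid:
      "trilevel_value X G \<Omega>
         (\<lambda>x h. min_value c (lp_set A b B (coupling_rhs B\<^sub>x B\<^sub>h b\<^sub>0 x h)))
       = trilevel_value X G (\<Omega> \<inter> {h. hlo \<le> h \<and> h \<le> hup})
         (\<lambda>x h. bounded_dual_value c A b B (coupling_rhs B\<^sub>x B\<^sub>h b\<^sub>0 x h) \<beta>lo \<beta>up)"
    and h_nonneg: "\<forall>h \<in> \<Omega> \<inter> {h. hlo \<le> h \<and> h \<le> hup}. h \<ge> 0"
  shows
    "trilevel_value X G \<Omega>
       (\<lambda>x h. min_value c (third_level_set A' b' B (coupling_rhs B\<^sub>x B\<^sub>h b\<^sub>0 x h)))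
     \<le> Inf {ereal (G x + \<beta>up \<bullet> u\<beta>p + \<beta>lo \<bullet> u\<beta>m + b\<^sub>\<Omega> \<bullet> u\<Omega> + c \<bullet> y
              - (\<Sum>i\<in>UNIV. \<Sum>j\<in>UNIV.
                   hlo $ i * \<beta>lo $ j * u1 $ i $ j + hup $ i * \<beta>up $ j * u2 $ i $ j
                 + hup $ i * \<beta>lo $ j * u3 $ i $ j + hlo $ i * \<beta>up $ j * u4 $ i $ j)) |
          (x :: real ^ 'm) (y :: real ^ ('n + 'l)) (u\<beta>p :: real ^ 'j) (u\<beta>m :: real ^ 'j)
          (u\<Omega> :: real ^ 'k) (u1 :: real ^ 'j ^ 'i) (u2 :: real ^ 'j ^ 'i)
          (u3 :: real ^ 'j ^ 'i) (u4 :: real ^ 'j ^ 'i).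
          A *v y \<ge> b \<and>
          (\<forall>j. (B *v y) $ j + u\<beta>p $ j + u\<beta>m $ j
                 - (\<Sum>i\<in>UNIV. hlo $ i * u1 $ i $ j + hup $ i * u2 $ i $ j
                            + hup $ i * u3 $ i $ j + hlo $ i * u4 $ i $ j)
               \<ge> (B\<^sub>x *v x + b\<^sub>0) $ j) \<and>
          u\<beta>p \<ge> 0 \<and> - u\<beta>m \<ge> 0 \<and>
          (\<forall>i. (A\<^sub>\<Omega> *v u\<Omega>) $ i
                 - (\<Sum>j\<in>UNIV. \<beta>lo $ j * u1 $ i $ j + \<beta>up $ j * u2 $ i $ j
                            + \<beta>lo $ j * u3 $ i $ j + \<beta>up $ j * u4 $ i $ j)
               \<ge> 0) \<and>
          B\<^sub>\<Omega> *v u\<Omega> \<ge> 0 \<and>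
          (\<forall>i j. u1 $ i $ j + u2 $ i $ j + u3 $ i $ j + u4 $ i $ j \<ge> B\<^sub>h $ j $ i) \<and>
          (\<forall>i j. - u1 $ i $ j \<ge> 0 \<and> - u2 $ i $ j \<ge> 0 \<and> u3 $ i $ j \<ge> 0 \<and> u4 $ i $ j \<ge> 0) \<and>
          x \<in> X}"
proof (rule Inf_greatest, elim CollectE exE conjE, hypsubst)
  fix x y u\<beta>p u\<beta>m u\<Omega> and u1 u2 u3 u4 :: "real ^ 'j ^ 'i"
  assume y: "A *v y \<ge> b"
    and rows: "\<forall>j. (B *v y) $ j + u\<beta>p $ j + u\<beta>m $ j
                 - (\<Sum>i\<in>UNIV. hlo $ i * u1 $ i $ j + hup $ i * u2 $ i $ j
                            + hup $ i * u3 $ i $ j + hlo $ i * u4 $ i $ j)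
               \<ge> (B\<^sub>x *v x + b\<^sub>0) $ j"
    and u\<beta>: "u\<beta>p \<ge> 0" "- u\<beta>m \<ge> 0"
    and u_rows: "\<forall>i. (A\<^sub>\<Omega> *v u\<Omega>) $ i
                 - (\<Sum>j\<in>UNIV. \<beta>lo $ j * u1 $ i $ j + \<beta>up $ j * u2 $ i $ j
                            + \<beta>lo $ j * u3 $ i $ j + \<beta>up $ j * u4 $ i $ j)
               \<ge> 0" "B\<^sub>\<Omega> *v u\<Omega> \<ge> 0"
    and cover: "\<forall>i j. u1 $ i $ j + u2 $ i $ j + u3 $ i $ j + u4 $ i $ j \<ge> B\<^sub>h $ j $ i"
    and sign: "\<forall>i j. - u1 $ i $ j \<ge> 0 \<and> - u2 $ i $ j \<ge> 0 \<and> u3 $ i $ j \<ge> 0 \<and> u4 $ i $ j \<ge> 0"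
    and x: "x \<in> X"
  define v where "v = \<beta>up \<bullet> u\<beta>p + \<beta>lo \<bullet> u\<beta>m + b\<^sub>\<Omega> \<bullet> u\<Omega> + c \<bullet> y
     - (\<Sum>i\<in>UNIV. \<Sum>j\<in>UNIV.
           hlo $ i * \<beta>lo $ j * u1 $ i $ j + hup $ i * \<beta>up $ j * u2 $ i $ j
         + hup $ i * \<beta>lo $ j * u3 $ i $ j + hlo $ i * \<beta>up $ j * u4 $ i $ j)"
  have um: "u\<beta>m \<le> 0"
    using u\<beta>(2) by (simp add: less_eq_vec_def)
  have "trilevel_value X G \<Omega>
       (\<lambda>x h. min_value c (third_level_set A' b' B (coupling_rhs B\<^sub>x B\<^sub>h b\<^sub>0 x h)))
     \<le> trilevel_value X G \<Omega> (\<lambda>x h. min_value c (lp_set A b B (coupling_rhs B\<^sub>x B\<^sub>h b\<^sub>0 x h)))"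
    unfolding min_value_def A_eq b_eq
    by (intro trilevel_value_mono INF_superset_mono order_refl
        lp_set_fixing_subset_third_level_set[OF y'_binary fixing])
  also note bounds_valid
  also have "trilevel_value X G (\<Omega> \<inter> {h. hlo \<le> h \<and> h \<le> hup})
         (\<lambda>x h. bounded_dual_value c A b B (coupling_rhs B\<^sub>x B\<^sub>h b\<^sub>0 x h) \<beta>lo \<beta>up)
       \<le> ereal (G x + v)"
    using x
  proof (rule trilevel_value_le)
    fix h assume h: "h \<in> \<Omega> \<inter> {h. hlo \<le> h \<and> h \<le> hup}"
    then obtain \<eta> where \<eta>: "\<eta> \<ge> 0" "transpose A\<^sub>\<Omega> *v h + transpose B\<^sub>\<Omega> *v \<eta> = b\<^sub>\<Omega>"
      using \<Omega>_eq by auto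
    have "b \<bullet> \<alpha> + (B\<^sub>x *v x + b\<^sub>0 + B\<^sub>h *v h) \<bullet> \<beta> \<le> v"
      if "transpose A *v \<alpha> + transpose B *v \<beta> = c" "\<alpha> \<ge> 0" "\<beta> \<ge> 0" "\<beta>lo \<le> \<beta>" "\<beta> \<le> \<beta>up" for \<alpha> \<beta>
      unfolding v_def
      using that \<eta> h h_nonneg y rows u\<beta>(1) um u_rows cover sign
      by (intro dual_objective_le_compact_objective) auto
    thus "bounded_dual_value c A b B (coupling_rhs B\<^sub>x B\<^sub>h b\<^sub>0 x h) \<beta>lo \<beta>up \<le> ereal v"
      unfolding bounded_dual_value_def coupling_rhs_def
      by (intro SUP_least) (auto simp: ac_simps)
  qed
  finally show "trilevel_value X G \<Omega>
       (\<lambda>x h. min_value c (third_level_set A' b' B (coupling_rhs B\<^sub>x B\<^sub>h b\<^sub>0 x h)))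
     \<le> ereal (G x + \<beta>up \<bullet> u\<beta>p + \<beta>lo \<bullet> u\<beta>m + b\<^sub>\<Omega> \<bullet> u\<Omega> + c \<bullet> y
              - (\<Sum>i\<in>UNIV. \<Sum>j\<in>UNIV.
                   hlo $ i * \<beta>lo $ j * u1 $ i $ j + hup $ i * \<beta>up $ j * u2 $ i $ j
                 + hup $ i * \<beta>lo $ j * u3 $ i $ j + hlo $ i * \<beta>up $ j * u4 $ i $ j))"
    by (simp add: v_def add.assoc add_diff_eq)
qed

end
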